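(* Let $G$ be a connected graph of order at least three. Then every outer mutual-visibility set of $G$ is independent if and only if $G$ is edge-critical.
   Context: All graphs are finite and simple. For $X\subseteq V(G)$, two vertices $u,v$ are $X$-visible if there is a shortest $u,v$-path $P$ in $G$ with $V(P)\cap X\subseteq\{u,v\}$. A set $X$ is an outer mutual-visibility set if any two vertices of $X$ are $X$-visible and any $x\in X$, $y\in V(G)\setminus X$ are $X$-visible. A set is independent if it induces no edge. An edge $xy$ of $G$ is critical if there exist vertices $u,v$ with $\{u,v\}\neq\{x,y\}$ such that $d_{G-xy}(u,v)>d_G(u,v)$ (distance $\infty$ if disconnected); $G$ is edge-critical if all its edges are critical. *)

theory Defs
  imports "Graph_Theory.Shortest_Path" "Graph_Theory.Digraph_Component"
begin

text \<open>
  A finite simple graph is a symmetric, loop-free digraph without parallel arcs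
  (locale \<^locale>\<open>graph\<close>); the edge \<open>xy\<close> is the pair of arcs \<open>x \<rightarrow> y\<close>, \<open>y \<rightarrow> x\<close>.
  Paths are given by \<^const>\<open>pre_digraph.apath\<close>, as lists of arcs.
\<close>

text \<open>The distance is \<open>\<infinity>\<close> when there is no walk from \<open>u\<close> to \<open>v\<close>.\<close>

definition graph_dist :: "('a, 'b) pre_digraph \<Rightarrow> 'a \<Rightarrow> 'a \<Rightarrow> ereal" where
  "graph_dist G u v = wf_digraph.\<mu> G (\<lambda>_. 1) u v"

definition shortest_path :: "('a, 'b) pre_digraph \<Rightarrow> 'a \<Rightarrow> 'b awalk \<Rightarrow> 'a \<Rightarrow> bool" where
  "shortest_path G u p v \<longleftrightarrow>
     pre_digraph.apath G u p v \<and> ereal (real (length p)) = graph_dist G u v"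

definition visible :: "('a, 'b) pre_digraph \<Rightarrow> 'a set \<Rightarrow> 'a \<Rightarrow> 'a \<Rightarrow> bool" where
  "visible G X u v \<longleftrightarrow>
     (\<exists>p. shortest_path G u p v \<and> set (pre_digraph.awalk_verts G u p) \<inter> X \<subseteq> {u, v})"

definition outer_mutual_visibility_set :: "('a, 'b) pre_digraph \<Rightarrow> 'a set \<Rightarrow> bool" where
  "outer_mutual_visibility_set G X \<longleftrightarrow>
     X \<subseteq> verts G \<and>
     (\<forall>u\<in>X. \<forall>v\<in>X. u \<noteq> v \<longrightarrow> visible G X u v) \<and>
     (\<forall>x\<in>X. \<forall>y\<in>verts G - X. visible G X x y)"

definition independent_set :: "('a, 'b) pre_digraph \<Rightarrow> 'a set \<Rightarrow> bool" where
  "independent_set G X \<longleftrightarrow> X \<subseteq> verts G \<and> arcs (G \<restriction> X) = {}"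

definition delete_edge :: "('a, 'b) pre_digraph \<Rightarrow> 'a \<Rightarrow> 'a \<Rightarrow> ('a, 'b) pre_digraph" where
  "delete_edge G x y = G\<lparr>arcs := {e \<in> arcs G. {tail G e, head G e} \<noteq> {x, y}}\<rparr>"

definition critical_edge :: "('a, 'b) pre_digraph \<Rightarrow> 'a \<Rightarrow> 'a \<Rightarrow> bool" where
  "critical_edge G x y \<longleftrightarrow>
     x \<rightarrow>\<^bsub>G\<^esub> y \<and>
     (\<exists>u\<in>verts G. \<exists>v\<in>verts G.
        {u, v} \<noteq> {x, y} \<and> graph_dist (delete_edge G x y) u v > graph_dist G u v)"

definition edge_critical :: "('a, 'b) pre_digraph \<Rightarrow> bool" where
  "edge_critical G \<longleftrightarrow> (\<forall>x y. x \<rightarrow>\<^bsub>G\<^esub> y \<longrightarrow> critical_edge G x y)"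

end

theory Submission
  imports Defs
begin

text \<open>
  If \<open>xy\<close> is not critical, then deleting it preserves the distances from \<open>x\<close> and from \<open>y\<close> to
  every other vertex \<open>z\<close>. A shortest \<open>x,z\<close>-path that avoids the edge \<open>xy\<close> avoids the vertex \<open>y\<close>,
  because \<open>y\<close> is at distance one from \<open>x\<close>; hence \<open>{x, y}\<close> is an outer mutual-visibility set.

  Conversely, let \<open>xy\<close> be critical, witnessed by \<open>u, v\<close>, and let a shortest \<open>u,v\<close>-path traverse
  \<open>x \<rightarrow> y\<close>, where \<open>v \<noteq> y\<close> up to reversal. If \<open>x\<close> and \<open>y\<close> were in an outer mutual-visibility set,
  then a shortest \<open>x,v\<close>-path avoiding \<open>y\<close> would replace the part after \<open>x\<close>, giving a \<open>u,v\<close>-walk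
  of the same length in \<open>G - xy\<close>.
\<close>

section \<open>Walk lengths, distances and reversal\<close>

lemma (in wf_digraph) awalk_cost_const_1: "awalk_cost (\<lambda>_. 1) p = real (length p)"
  by (induction p) auto

lemma (in wf_digraph) graph_dist_le_length:
  assumes "awalk u p v"
  shows "graph_dist G u v \<le> ereal (real (length p))"
  using min_cost_le_walk_cost[OF assms, of "\<lambda>_. 1"]
  by (simp add: graph_dist_def awalk_cost_const_1)

lemma (in fin_digraph) shortest_path_exists:
  assumes "u \<rightarrow>\<^sup>* v"
  obtains p where "shortest_path G u p v"
proof -
  obtain p where "apath u p v" "\<mu> (\<lambda>_. 1) u v = awalk_cost (\<lambda>_. 1) p"
    using min_cost_awalk[OF assms, of "\<lambda>_. 1"] by auto
  then show thesis
    by (intro that[of p]) (simp add: shortest_path_def graph_dist_def awalk_cost_const_1)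
qed

lemma (in wf_digraph) shortest_path_length_le:
  assumes "shortest_path G u p v" "awalk u q v"
  shows "length p \<le> length q"
proof -
  have "ereal (real (length p)) \<le> ereal (real (length q))"
    using graph_dist_le_length[OF assms(2)] assms(1) by (simp add: shortest_path_def)
  then show ?thesis by simp
qed

text \<open>Walks are lists of arcs, so besides reversing the order each arc is exchanged for an
  opposite one, which symmetry supplies.\<close>

lemma (in sym_digraph) awalk_reverse:
  assumes "awalk u p v"
  obtains q where "awalk v q u" "length q = length p"
proof -
  have "\<exists>q. awalk v q u \<and> length q = length p"
    using assms
  proof (induction p arbitrary: u)
    case Nil
    then show ?case by (auto simp: awalk_Nil_iff)
  next
    case (Cons e p)
    then have e: "e \<in> arcs G" "u = tail G e" and p: "awalk (head G e) p v"
      by (auto simp: awalk_Cons_iff)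
    obtain q where q: "awalk v q (head G e)" "length q = length p"
      using Cons.IH[OF p] by blast
    obtain f where f: "f \<in> arcs G" "tail G f = head G e" "head G f = tail G e"
      using sym_arcs e unfolding symmetric_conv by metis
    have "awalk v (q @ [f]) u"
      using awalk_appendI[OF q(1)] arc_implies_awalk[OF f(1)] f e by simp
    then show ?case using q(2) by (intro exI[of _ "q @ [f]"]) simp
  qed
  then show thesis using that by blast
qed

lemma (in sym_digraph) graph_dist_commute:
  "graph_dist G u v = graph_dist G v u"
proof -
  have "graph_dist G v u \<le> graph_dist G u v" for u v
    unfolding graph_dist_def[of G u v] \<mu>_def
  proof (rule INF_greatest)
    fix p assume "p \<in> {p. awalk u p v}"
    then obtain q where "awalk v q u" "length q = length p"
      using awalk_reverse by blast
    then show "graph_dist G v u \<le> ereal (awalk_cost (\<lambda>_. 1) p)"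
      using graph_dist_le_length awalk_cost_const_1 by metis
  qed
  then show ?thesis by (meson antisym)
qed

section \<open>Deletion of an edge\<close>

lemma verts_delete_edge [simp]: "verts (delete_edge G x y) = verts G"
  and arcs_delete_edge:
    "arcs (delete_edge G x y) = {e \<in> arcs G. {tail G e, head G e} \<noteq> {x, y}}"
  and tail_delete_edge [simp]: "tail (delete_edge G x y) = tail G"
  and head_delete_edge [simp]: "head (delete_edge G x y) = head G"
  by (simp_all add: delete_edge_def)

lemma delete_edge_commute: "delete_edge G x y = delete_edge G y x"
  by (simp add: delete_edge_def insert_commute)

lemma awalk_verts_delete_edge [simp]:
  "pre_digraph.awalk_verts (delete_edge G x y) u p = pre_digraph.awalk_verts G u p"
  by (induction p arbitrary: u) (simp_all add: pre_digraph.awalk_verts.simps)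

lemma cas_delete_edge [simp]:
  "pre_digraph.cas (delete_edge G x y) u p v = pre_digraph.cas G u p v"
  by (induction p arbitrary: u) (simp_all add: pre_digraph.cas.simps)

lemma awalk_delete_edge_iff:
  "pre_digraph.awalk (delete_edge G x y) u p v \<longleftrightarrow>
     pre_digraph.awalk G u p v \<and> (\<forall>e\<in>set p. {tail G e, head G e} \<noteq> {x, y})"
  by (auto simp: pre_digraph.awalk_def arcs_delete_edge)

lemma (in fin_digraph) fin_digraph_delete_edge: "fin_digraph (delete_edge G x y)"
  by unfold_locales (auto simp: arcs_delete_edge)

text \<open>Arcs are removed according to their unordered pair of ends, so an arc and its opposite
  survive or vanish together.\<close>

lemma (in sym_digraph) sym_digraph_delete_edge: "sym_digraph (delete_edge G x y)"
proof
  show "symmetric (delete_edge G x y)"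
    unfolding symmetric_conv
  proof
    fix e assume e: "e \<in> arcs (delete_edge G x y)"
    then obtain f where "f \<in> arcs G" "tail G e = head G f" "head G e = tail G f"
      using sym_arcs unfolding symmetric_conv by (auto simp: arcs_delete_edge)
    with e show "\<exists>f\<in>arcs (delete_edge G x y). tail (delete_edge G x y) e = head (delete_edge G x y) f
        \<and> head (delete_edge G x y) e = tail (delete_edge G x y) f"
      by (intro bexI[of _ f]) (auto simp: arcs_delete_edge insert_commute)
  qed
qed (auto simp: arcs_delete_edge)

section \<open>Visibility from an end of a non-critical edge\<close>

lemma (in fin_digraph) visible_if_delete_edge_preserves_dist:
  assumes xy: "x \<rightarrow>\<^bsub>G\<^esub> y" "x \<noteq> y" and reach: "x \<rightarrow>\<^sup>* z"
    and dist: "graph_dist (delete_edge G x y) x z \<le> graph_dist G x z"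
  shows "visible G {x, y} x z"
proof -
  interpret H: fin_digraph "delete_edge G x y"
    by (rule fin_digraph_delete_edge)
  have "graph_dist G x z < \<infinity>"
    using reach \<mu>_reach_conv by (simp add: graph_dist_def)
  \<comment> \<open>By \<open>dist\<close>, the finite distance stays finite after the
    deletion.\<close>
  then have "x \<rightarrow>\<^sup>*\<^bsub>delete_edge G x y\<^esub> z"
    using dist H.\<mu>_reach_conv[of "\<lambda>_. 1" x z] by (auto simp: graph_dist_def)
  then obtain p where p: "shortest_path (delete_edge G x y) x p z"
    by (rule H.shortest_path_exists)
  then have walk: "awalk x p z" and avoid: "\<forall>e\<in>set p. {tail G e, head G e} \<noteq> {x, y}"
    and "distinct (awalk_verts x p)"
    by (auto simp: shortest_path_def H.apath_def awalk_delete_edge_iff)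
  \<comment> \<open>\<open>dist\<close> bounds \<open>length p\<close> from above; from below,
    \<open>p\<close> is also a walk in \<open>G\<close>.\<close>
  moreover have "ereal (real (length p)) = graph_dist G x z"
    using p dist graph_dist_le_length[OF walk] by (auto simp: shortest_path_def)
  ultimately have short: "shortest_path G x p z"
    by (simp add: shortest_path_def apath_def)
  have "y \<notin> set (awalk_verts x p)"
  proof
    assume "y \<in> set (awalk_verts x p)"
    then obtain q r where p_eq: "p = q @ r" and q: "awalk x q y" and r: "awalk y r z"
      using awalk_decomp[OF walk] by blast
    obtain e where e: "e \<in> arcs G" "tail G e = x" "head G e = y"
      using xy(1) by (auto simp: arcs_ends_conv)
    \<comment> \<open>Replacing \<open>q\<close> by the arc \<open>e\<close> cannot shorten
      \<open>p\<close>, so \<open>q\<close> has at most one arc.\<close>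
    have "awalk x (e # r) z"
      using e r by (simp add: awalk_Cons_iff)
    then have "length q \<le> 1"
      using shortest_path_length_le[OF short] p_eq by fastforce
    then consider "q = []" | f where "q = [f]"
      by (cases q) auto
    then show False
    proof cases
      case 1
      then show False using q xy(2) by (simp add: awalk_Nil_iff)
    next
      case 2
      \<comment> \<open>The only arc of \<open>q\<close> would join \<open>x\<close> to
        \<open>y\<close>, and such arcs were deleted.\<close>
      then show False using q p_eq avoid by (auto simp: awalk_simps)
    qed
  qed
  then show ?thesis
    using short unfolding visible_def by blast
qed

section \<open>Exchange along a critical edge\<close>

text \<open>By \<open>len\<close>, the walk \<open>q\<close>, \<open>e\<close>, \<open>r\<close> is
  shortest. Visibility replaces \<open>e\<close>, \<open>r\<close> by a path missing
  \<open>y\<close>, and \<open>q\<close> misses \<open>y\<close> by minimality, so the new walk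
  survives the deletion. Fixing the direction of \<open>e\<close> leaves the case of
  \<open>v\<close> equal to \<open>y\<close> to reversal.\<close>

lemma (in wf_digraph) outer_mutual_visibility_set_dist_delete_edge_le:
  assumes X: "outer_mutual_visibility_set G X" "x \<in> X" "y \<in> X"
    and e: "e \<in> arcs G" "tail G e = x" "head G e = y" "x \<noteq> y"
    and q: "awalk u q x" and r: "awalk y r v" and "v \<noteq> y"
    and len: "ereal (real (length q + length r + 1)) \<le> graph_dist G u v"
  shows "graph_dist (delete_edge G x y) u v \<le> graph_dist G u v"
proof -
  interpret H: wf_digraph "delete_edge G x y"
    by unfold_locales (auto simp: arcs_delete_edge)
  have min: "length q + length r + 1 \<le> length p" if "awalk u p v" for p
  proof -
    have "ereal (real (length q + length r + 1)) \<le> ereal (real (length p))"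
      using len graph_dist_le_length[OF that] by (rule order_trans)
    then show ?thesis by simp
  qed
  \<comment> \<open>Otherwise \<open>q\<close> alone would be a shorter walk from \<open>u\<close>
    to \<open>v\<close>.\<close>
  have "v \<noteq> x"
    using min[of q] q by auto
  \<comment> \<open>The two clauses of the definition cover \<open>v\<close> inside and outside
    \<open>X\<close>.\<close>
  then have "visible G X x v"
    using X awalk_last_in_verts[OF r] unfolding outer_mutual_visibility_set_def by (cases "v \<in> X") auto
  then obtain s where s: "shortest_path G x s v" "set (awalk_verts x s) \<inter> X \<subseteq> {x, v}"
    unfolding visible_def by blast
  then have s_walk: "awalk x s v"
    by (simp add: shortest_path_def apath_def)
  have "length s \<le> length (e # r)"
    by (rule shortest_path_length_le[OF s(1)]) (use e r in \<open>simp add: awalk_Cons_iff\<close>)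
  have "y \<notin> set (awalk_verts x s)"
    using s(2) \<open>y \<in> X\<close> \<open>x \<noteq> y\<close> \<open>v \<noteq> y\<close> by blast
  moreover have "y \<notin> set (awalk_verts u q)"
  proof
    assume "y \<in> set (awalk_verts u q)"
    then obtain q1 q2 where "q = q1 @ q2" "awalk u q1 y"
      using awalk_decomp[OF q] by blast
    \<comment> \<open>Going on from \<open>y\<close> along \<open>r\<close> skips at least the arc
      \<open>e\<close>.\<close>
    then show False
      using min[OF awalk_appendI[OF _ r]] by fastforce
  qed
  ultimately have "{tail G f, head G f} \<noteq> {x, y}" if "f \<in> set (q @ s)" for f
    using that awalk_verts_arc1 awalk_verts_arc2[OF q] awalk_verts_arc2[OF s_walk]
    by (auto simp: doubleton_eq_iff)
  then have "H.awalk u (q @ s) v"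
    using awalk_appendI[OF q s_walk] by (simp add: awalk_delete_edge_iff del: awalk_append_iff)
  then have "graph_dist (delete_edge G x y) u v \<le> ereal (real (length (q @ s)))"
    by (rule H.graph_dist_le_length)
  also have "\<dots> \<le> ereal (real (length q + length r + 1))"
    using \<open>length s \<le> length (e # r)\<close> by simp
  finally show ?thesis using len by order
qed

lemma (in graph) no_critical_edge_in_outer_mutual_visibility_set:
  assumes X: "outer_mutual_visibility_set G X" "x \<in> X" "y \<in> X"
  shows "\<not> critical_edge G x y"
proof
  interpret H: sym_digraph "delete_edge G x y"
    by (rule sym_digraph_delete_edge)
  assume "critical_edge G x y"
  then obtain u v where uv: "{u, v} \<noteq> {x, y}"
      "graph_dist (delete_edge G x y) u v > graph_dist G u v"
    by (auto simp: critical_edge_def)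
  have "graph_dist G u v < \<infinity>"
    using uv(2) by auto
  then have "u \<rightarrow>\<^sup>* v"
    using \<mu>_reach_conv by (simp add: graph_dist_def)
  then obtain p where p: "shortest_path G u p v"
    by (rule shortest_path_exists)
  then have walk: "awalk u p v" and len: "ereal (real (length p)) = graph_dist G u v"
    by (auto simp: shortest_path_def apath_def)
  \<comment> \<open>If \<open>p\<close> survived the deletion, the distance would not grow.\<close>
  have "\<not> H.awalk u p v"
    using H.graph_dist_le_length[of u p v] uv(2) len by auto
  then obtain e where e: "e \<in> set p" "{tail G e, head G e} = {x, y}"
    using walk by (auto simp: awalk_delete_edge_iff)
  \<comment> \<open>These are the ends of the edge in the order in which \<open>p\<close> traverses
    it.\<close>
  define a b where "a = tail G e" and "b = head G e"
  have ab: "{a, b} = {x, y}" and del: "delete_edge G x y = delete_edge G a b"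
    using e(2) delete_edge_commute by (auto simp: a_def b_def doubleton_eq_iff)
  have X': "a \<in> X" "b \<in> X"
    using ab X by (auto simp: doubleton_eq_iff)
  obtain q r where p_eq: "p = q @ e # r"
    using e(1) by (auto simp: in_set_conv_decomp)
  then have e_arc: "e \<in> arcs G" and q: "awalk u q a" and r: "awalk b r v"
    using walk by (auto simp: a_def b_def awalk_Cons_iff)
  have "a \<noteq> b"
    using no_loops[OF e_arc] by (simp add: a_def b_def)
  have len': "real (length q + length r + 1) = length p"
    using p_eq by simp
  show False
  proof (cases "v = b")
    case False
    then show False
      using outer_mutual_visibility_set_dist_delete_edge_le[OF X(1) X' e_arc _ _ \<open>a \<noteq> b\<close> q r] len len' uv(2) del
      by (simp add: a_def b_def)
  next
    case True
    \<comment> \<open>As \<open>p\<close> ends with the edge and its ends are not both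
      \<open>a\<close> and \<open>b\<close>, the start \<open>u\<close> differs from
      \<open>a\<close>; the exchange therefore applies to the reversed walk.\<close>
    then have "u \<noteq> a"
      using uv(1) ab by auto
    obtain f where f: "f \<in> arcs G" "tail G f = b" "head G f = a"
      using sym_arcs e_arc unfolding symmetric_conv a_def b_def by metis
    obtain q' where q': "awalk a q' u" "length q' = length q"
      using awalk_reverse[OF q] .
    obtain r' where r': "awalk v r' b" "length r' = length r"
      using awalk_reverse[OF r] .
    have "ereal (real (length r' + length q' + 1)) \<le> graph_dist G v u"
      using len len' q'(2) r'(2) graph_dist_commute[of u v] by (simp add: ac_simps)
    then have "graph_dist (delete_edge G b a) v u \<le> graph_dist G v u"
      using outer_mutual_visibility_set_dist_delete_edge_le[OF X(1) X'(2,1) f _ r'(1) q'(1)] \<open>u \<noteq> a\<close> \<open>a \<noteq> b\<close>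
      by simp
    then show False
      using uv(2) graph_dist_commute[of u v] H.graph_dist_commute[of u v] del
        delete_edge_commute[of G a b] by simp
  qed
qed

section \<open>Non-critical edges as visibility sets, and the equivalence\<close>

lemma (in graph) outer_mutual_visibility_set_if_not_critical:
  assumes sc: "strongly_connected G" and xy: "x \<rightarrow>\<^bsub>G\<^esub> y" and "\<not> critical_edge G x y"
  shows "outer_mutual_visibility_set G {x, y}"
proof -
  have yx: "y \<rightarrow>\<^bsub>G\<^esub> x"
    using xy sym_arcs by (simp add: symmetric_def sym_def)
  have neq: "x \<noteq> y" "y \<noteq> x"
    using xy adj_not_same[of x] by auto
  have verts: "x \<in> verts G" "y \<in> verts G"
    using xy by (auto dest: adj_in_verts)
  have reach: "u \<rightarrow>\<^sup>* v" if "u \<in> verts G" "v \<in> verts G" for u v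
    using sc that by blast
  have dist: "graph_dist (delete_edge G x y) u v \<le> graph_dist G u v"
    if "u \<in> verts G" "v \<in> verts G" "{u, v} \<noteq> {x, y}" for u v
    using assms(3) xy that unfolding critical_edge_def by (meson not_less)
  \<comment> \<open>Both members of the set are ends of the path, so any shortest path will
    do.\<close>
  have "visible G {x, y} u v" if "u \<in> {x, y}" "v \<in> {x, y}" "u \<noteq> v" for u v
  proof -
    have "u \<rightarrow>\<^sup>* v"
      using that(1,2) verts by (intro reach) auto
    then obtain p where "shortest_path G u p v"
      by (rule shortest_path_exists)
    moreover have "{x, y} \<subseteq> {u, v}"
      using that by auto
    ultimately show ?thesis
      unfolding visible_def by (intro exI[of _ p]) (simp add: le_infI2)
  qed
  moreover have "visible G {x, y} u z" if "u \<in> {x, y}" "z \<in> verts G - {x, y}" for u z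
  proof -
    \<comment> \<open>As \<open>z\<close> is neither end of the edge, the pairs of \<open>x\<close>
      and \<open>z\<close> and of \<open>y\<close> and \<open>z\<close> differ from the edge, and
      \<open>dist\<close> applies to both.\<close>
    have z: "z \<in> verts G" "z \<noteq> x" "z \<noteq> y"
      using that by auto
    have "visible G {x, y} x z"
      using visible_if_delete_edge_preserves_dist[OF xy neq(1) reach dist] verts z
      by (simp add: doubleton_eq_iff)
    moreover have "visible G {y, x} y z"
      using visible_if_delete_edge_preserves_dist[OF yx neq(2) reach, of z] dist[of y z] verts z
      by (simp add: doubleton_eq_iff delete_edge_commute[of G y x])
    ultimately show ?thesis
      using that(1) by (auto simp: insert_commute[of y x])
  qed
  ultimately show ?thesis
    using verts by (simp add: outer_mutual_visibility_set_def)
qed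

theorem theorem3p1:
  fixes G :: "('a, 'b) pre_digraph"
  assumes "graph G"
    and "Digraph_Component.connected G"
    and "card (verts G) \<ge> 3"
  shows "(\<forall>X. outer_mutual_visibility_set G X \<longrightarrow> independent_set G X) \<longleftrightarrow> edge_critical G"
proof -
  interpret graph G by fact
  have sc: "strongly_connected G"
    using symmetric_connected_imp_strongly_connected[OF sym_arcs assms(2)] .
  show ?thesis
  proof (intro iffI allI impI)
    assume indep: "\<forall>X. outer_mutual_visibility_set G X \<longrightarrow> independent_set G X"
    show "edge_critical G"
      unfolding edge_critical_def
    proof (intro allI impI, rule ccontr)
      fix x y assume xy: "x \<rightarrow>\<^bsub>G\<^esub> y" "\<not> critical_edge G x y"
      \<comment> \<open>The hypothesis makes the ends of a non-critical edge independent, although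
        the edge joins them.\<close>
      then have "independent_set G {x, y}"
        using outer_mutual_visibility_set_if_not_critical[OF sc xy] indep by simp
      then have "arcs (G \<restriction> {x, y}) = {}"
        unfolding independent_set_def ..
      then show False
        using xy(1) by (auto simp: arcs_ends_conv)
    qed
  next
    fix X assume crit: "edge_critical G" and X: "outer_mutual_visibility_set G X"
    have "False" if "e \<in> arcs G" "tail G e \<in> X" "head G e \<in> X" for e
      using no_critical_edge_in_outer_mutual_visibility_set[OF X that(2,3)] crit
        in_arcs_imp_in_arcs_ends[OF that(1)] by (simp add: edge_critical_def)
    then show "independent_set G X"
      using X by (auto simp: independent_set_def outer_mutual_visibility_set_def)
  qed
qed

end
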